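(* Let $(G,A)$ be a simple edge-weighted graph with vertices $v_1,\dots,v_n$, and let $\{G_n,\dots,G_1\}$ be a complete collapse sequence of $(G,A)$. For $2\le i\le n$ define $\phi_i:S_{G_i}\to S_{G_{i-1}}$ by $\phi_i(g_1,\dots,g_i)=(g_1,\dots,g_{i-1})$, and define $\phi_1:S_{G_1}\to 0$ by $\phi_1(g_1)=0$; let $K_i=\ker\phi_i$. Then: (1) $S_G\cong K_1\oplus K_2\oplus\cdots\oplus K_n$ as $\mathbb{Z}$-modules. (2) Each $K_i$ is a rank $1$ submodule of $S_{G_i}$. (3) For $i>1$, let $c_1,\dots,c_d$ be the weights of the edges incident to $v_i$ in $G_i$. Then $m_1=(1)$ generates $K_1$, and $m_i=(0,0,\dots,0,\operatorname{lcm}(c_1,\dots,c_d))\in\mathbb{Z}^i$ generates $K_i$ for $i>1$. (4) For each $i<n$ let $M_i\in S_G$ be a pre-image of $m_i$ under $\phi_{i+1}\circ\cdots\circ\phi_{n-1}\circ\phi_n$, and let $M_n=m_n$. Then $\{M_1,\dots,M_n\}$ is a flow-up class basis of $S_G$, with $M_i\in\mathcal{F}_{i-1}$ for each $i$.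
   Context: An edge-weighted graph $(G,A)$ is a finite loopless graph $G$ (multiple edges allowed unless "simple" is stated) with vertex set $\{v_1,\dots,v_n\}$ and edge set $E$, together with a weight function $A:E\to\mathbb{Z}_{>0}$. A spline on $(G,A)$ is a tuple $(g_1,\dots,g_n)\in\mathbb{Z}^n$ such that $g_i\equiv g_j \pmod{A(e)}$ for every edge $e$ joining $v_i$ and $v_j$. The set of splines, $S_G$, is a $\mathbb{Z}$-submodule of $\mathbb{Z}^n$. A graph with one vertex and no edges has $S_{G}=\mathbb{Z}$. Star-clique operation: for a simple $(G,A)$ and a vertex $v$ with (distinct) neighbours $w_1,\dots,w_d$, where the edge $vw_k$ has weight $a_k$, the graph $(G_v,A_v)$ is obtained by deleting $v$ and all edges incident to $v$, and then, for each pair $j<k$, adding a new edge between $w_j$ and $w_k$ of weight $\gcd(a_j,a_k)$ (even if $w_j,w_k$ were already adjacent, which may create multiple edges); all other vertices and edges are unchanged. Edge-collapse operation: if edges $e_1,\dots,e_r$ ($r\ge2$) all join the same pair of vertices and have weights $a_1,\dots,a_r$, replace them by a single edge joining that pair with weight $\operatorname{lcm}(a_1,\dots,a_r)$. A complete collapse sequence of a simple $(G,A)$ with vertices $v_1,\dots,v_n$ is a sequence of simple edge-weighted graphs $G_n=G, G_{n-1},\dots,G_1$ where, for $2\le i\le n$, $G_{i-1}$ is obtained from $G_i$ by applying the star-clique operation to $v_i$ and then edge-collapsing all multiple edges; thus $G_i$ has vertices $v_1,\dots,v_i$ and $G_1$ is the single vertex $v_1$. Flow-up classes: for $0\le i<n$,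 $\mathcal{F}_i\subseteq S_G$ is the set of splines $(g_1,\dots,g_n)$ with $g_1=\cdots=g_i=0$ and $g_{i+1}\neq0$; $\mathcal{F}_n=\{0\}$. For $F\in\mathcal{F}_i$ ($i<n$) the leading term is $L(F)=g_{i+1}$. A minimal element of $\mathcal{F}_i$ is $B\in\mathcal{F}_i$ with $L(B)>0$ and $L(B)\le|L(F)|$ for all $F\in\mathcal{F}_i$. A flow-up class basis of $S_G$ is a $\mathbb{Z}$-basis $\{B_0,\dots,B_{n-1}\}$ of $S_G$ with each $B_i$ a minimal element of $\mathcal{F}_i$. The lcm of an empty set of integers is taken to be $1$. *)

theory Defs
  imports
    Complex_Main
    "HOL-Library.Multiset"
    "HOL-Library.FuncSet"
    "HOL-Library.Function_Algebras"
    "HOL-Number_Theory.Cong"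
begin

section \<open>Integer-valued functions as a module over the integers\<close>

definition zscale :: "int \<Rightarrow> ('a \<Rightarrow> int) \<Rightarrow> 'a \<Rightarrow> int" where
  "zscale c f = (\<lambda>x. c * f x)"

global_interpretation zmod: module "zscale :: int \<Rightarrow> ('a \<Rightarrow> int) \<Rightarrow> 'a \<Rightarrow> int"
  by unfold_locales (auto simp: zscale_def fun_eq_iff algebra_simps)

text \<open>The rank of a finitely generated free \<open>\<int>\<close>-module: the number of elements of a basis.\<close>

definition has_rank :: "('a \<Rightarrow> int) set \<Rightarrow> nat \<Rightarrow> bool" where
  "has_rank K r \<longleftrightarrow>
     (\<exists>B. finite B \<and> card B = r \<and> zmod.independent B \<and> zmod.span B = K)"

text \<open>
  Linearity between submodules of ambient types; \<open>s\<^sub>1\<close> and \<open>s\<^sub>2\<close> are the scalar multiplications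
  of the two ambient modules (as in \<open>module_hom\<close>, which however lives on whole types).
\<close>

definition zmod_hom_on ::
  "(int \<Rightarrow> 'a \<Rightarrow> 'a) \<Rightarrow> (int \<Rightarrow> 'b \<Rightarrow> 'b) \<Rightarrow> ('a :: ab_group_add) set \<Rightarrow> ('b :: ab_group_add) set
     \<Rightarrow> ('a \<Rightarrow> 'b) \<Rightarrow> bool" where
  "zmod_hom_on s1 s2 M N f \<longleftrightarrow>
     f \<in> M \<rightarrow> N \<and>
     (\<forall>x\<in>M. \<forall>y\<in>M. f (x + y) = f x + f y) \<and>
     (\<forall>c. \<forall>x\<in>M. f (s1 c x) = s2 c (f x))"

definition zmod_isomorphic ::
  "(int \<Rightarrow> 'a \<Rightarrow> 'a) \<Rightarrow> (int \<Rightarrow> 'b \<Rightarrow> 'b) \<Rightarrow> ('a :: ab_group_add) set \<Rightarrow> ('b :: ab_group_add) set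
     \<Rightarrow> bool" where
  "zmod_isomorphic s1 s2 M N \<longleftrightarrow> (\<exists>f. zmod_hom_on s1 s2 M N f \<and> bij_betw f M N)"

text \<open>External direct sum over a finite index set, with its componentwise scalar multiplication.\<close>

definition direct_sum :: "'i set \<Rightarrow> ('i \<Rightarrow> ('a \<Rightarrow> int) set) \<Rightarrow> ('i \<Rightarrow> 'a \<Rightarrow> int) set" where
  "direct_sum I K = {F. (\<forall>i\<in>I. F i \<in> K i) \<and> (\<forall>i. i \<notin> I \<longrightarrow> F i = 0)}"

definition dscale :: "int \<Rightarrow> ('i \<Rightarrow> 'a \<Rightarrow> int) \<Rightarrow> 'i \<Rightarrow> 'a \<Rightarrow> int" where
  "dscale c F = (\<lambda>i. zscale c (F i))"


section \<open>Edge-weighted graphs and splines\<close>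

text \<open>
  The vertex \<open>v\<^sub>i\<close> is the number \<open>i\<close>. A (multi)graph has a multiset of edges, each recorded as
  its set of two end points together with its weight; parallel edges, also those
  with equal weights, are thus separate occurrences in the multiset.
\<close>

record wgraph =
  verts :: "nat set"
  edges :: "(nat set \<times> int) multiset"

definition edge_weighted_graph :: "wgraph \<Rightarrow> bool" where
  "edge_weighted_graph G \<longleftrightarrow>
     finite (verts G) \<and> (\<forall>(e, a) \<in># edges G. e \<subseteq> verts G \<and> card e = 2 \<and> a > 0)"

definition simple_graph :: "wgraph \<Rightarrow> bool" where
  "simple_graph G \<longleftrightarrow>
     edge_weighted_graph G \<and> (\<forall>p. size {#x \<in># edges G. fst x = p#} \<le> 1)"

text \<open>
  Tuples indexed by the vertices are encoded as functions that vanish outside the vertex set,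
  so \<open>\<int>\<^sup>i\<close> is the set of functions supported on \<open>{1..i}\<close>.
\<close>

definition splines :: "wgraph \<Rightarrow> (nat \<Rightarrow> int) set" where
  "splines G = {g. (\<forall>i. i \<notin> verts G \<longrightarrow> g i = 0) \<and>
                   (\<forall>i j a. ({i, j}, a) \<in># edges G \<longrightarrow> [g i = g j] (mod a))}"


section \<open>Star-clique and edge-collapse operations\<close>

text \<open>
  Meant for simple graphs. The condition \<open>x < y\<close> picks each unordered
  pair of distinct neighbours exactly once.
\<close>

definition star_clique :: "nat \<Rightarrow> wgraph \<Rightarrow> wgraph" where
  "star_clique v G =
     \<lparr>verts = verts G - {v},
      edges = {#(e, a) \<in># edges G. v \<notin> e#} +
        image_mset (\<lambda>((x, a), (y, b)). ({x, y}, gcd a b))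
          (mset_set {((x, a), (y, b)). ({v, x}, a) \<in># edges G \<and> ({v, y}, b) \<in># edges G \<and> x < y})\<rparr>"

definition edge_collapse :: "wgraph \<Rightarrow> wgraph \<Rightarrow> bool" where
  "edge_collapse G H \<longleftrightarrow>
     (\<exists>p C. C \<subseteq># edges G \<and> size C \<ge> 2 \<and> (\<forall>x \<in># C. fst x = p) \<and>
        H = G\<lparr>edges := edges G - C + {#(p, Lcm (snd ` set_mset C))#}\<rparr>)"

text \<open>
  \<open>Gs i\<close> is the \<open>i\<close>-th graph for \<open>1 \<le> i \<le> n\<close>. Collapsing \<^emph>\<open>all\<close> multiple edges means
  performing collapses until the graph is simple.
\<close>

definition complete_collapse_sequence :: "nat \<Rightarrow> wgraph \<Rightarrow> (nat \<Rightarrow> wgraph) \<Rightarrow> bool" where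
  "complete_collapse_sequence n G Gs \<longleftrightarrow>
     Gs n = G \<and>
     (\<forall>i\<in>{1..n}. simple_graph (Gs i)) \<and>
     (\<forall>i\<in>{2..n}. edge_collapse\<^sup>*\<^sup>* (star_clique i (Gs i)) (Gs (i - 1)))"


section \<open>Flow-up classes\<close>

text \<open>Here \<open>G\<close> is a graph with vertices \<open>1, \<dots>, n\<close>.\<close>

definition flow_up :: "nat \<Rightarrow> wgraph \<Rightarrow> nat \<Rightarrow> (nat \<Rightarrow> int) set" where
  "flow_up n G i =
     (if i < n then {g \<in> splines G. (\<forall>j\<in>{1..i}. g j = 0) \<and> g (i + 1) \<noteq> 0} else {0})"

definition leading_term :: "nat \<Rightarrow> (nat \<Rightarrow> int) \<Rightarrow> int" where
  "leading_term i g = g (i + 1)"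

definition minimal_element :: "nat \<Rightarrow> wgraph \<Rightarrow> nat \<Rightarrow> (nat \<Rightarrow> int) \<Rightarrow> bool" where
  "minimal_element n G i B \<longleftrightarrow>
     B \<in> flow_up n G i \<and> leading_term i B > 0 \<and>
     (\<forall>F \<in> flow_up n G i. leading_term i B \<le> \<bar>leading_term i F\<bar>)"

definition flow_up_class_basis :: "nat \<Rightarrow> wgraph \<Rightarrow> (nat \<Rightarrow> int) set \<Rightarrow> bool" where
  "flow_up_class_basis n G \<B> \<longleftrightarrow>
     (\<exists>B. \<B> = B ` {0..<n} \<and> (\<forall>i<n. minimal_element n G i (B i))) \<and>
     zmod.independent \<B> \<and> zmod.span \<B> = splines G"


section \<open>The maps between consecutive spline modules\<close>

text \<open>Forgets the \<open>i\<close>-th entry of a tuple in \<open>\<int>\<^sup>i\<close>; for \<open>i = 1\<close> this is the zero map.\<close>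

definition phi :: "nat \<Rightarrow> (nat \<Rightarrow> int) \<Rightarrow> nat \<Rightarrow> int" where
  "phi i g = (\<lambda>j. if 1 \<le> j \<and> j < i then g j else 0)"

text \<open>The composition of \<open>phi (i + 1), \<dots>, phi n\<close>, where \<open>phi n\<close> is applied first.\<close>

definition phi_comp :: "nat \<Rightarrow> nat \<Rightarrow> (nat \<Rightarrow> int) \<Rightarrow> nat \<Rightarrow> int" where
  "phi_comp i n = foldr (\<circ>) (map phi [i + 1..<n + 1]) id"

definition ker_phi :: "(nat \<Rightarrow> wgraph) \<Rightarrow> nat \<Rightarrow> (nat \<Rightarrow> int) set" where
  "ker_phi Gs i = {g \<in> splines (Gs i). phi i g = 0}"

definition kernel_gen :: "(nat \<Rightarrow> wgraph) \<Rightarrow> nat \<Rightarrow> nat \<Rightarrow> int" where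
  "kernel_gen Gs i =
     (\<lambda>j. if j = i
          then (if i = 1 then 1 else Lcm {c. \<exists>e. (e, c) \<in># edges (Gs i) \<and> i \<in> e})
          else 0)"

end

theory Submission
  imports Defs
begin

text \<open>
  Edge collapses do not change the splines, since a congruence modulo an lcm is the conjunction
  of the congruences modulo the individual weights. By the Chinese remainder theorem for moduli
  that need not be coprime, a spline on the star-clique at \<open>v\<close> extends to \<open>v\<close>, because the clique
  edges express exactly the pairwise compatibility of the congruences at \<open>v\<close>. Hence each \<open>phi i\<close>
  is onto, and its kernel consists of the multiples of \<open>kernel_gen Gs i\<close>. Preimages of these
  generators are triangular, and their diagonal entries divide the leading term of every
  spline in the corresponding flow-up class; so they form a minimal basis.
\<close>

section \<open>Collapses and splines\<close>

text \<open>In the divisibility lattice gcd distributes over lcm, so \<open>gcd a (Lcm S)\<close> is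
  the lcm of all \<open>gcd a s\<close>. For empty \<open>S\<close> it is
  \<open>gcd a 1 = 1\<close>.\<close>

lemma dvd_gcd_Lcm_int:
  fixes a x :: int
  assumes "finite S" "\<And>s. s \<in> S \<Longrightarrow> gcd a s dvd x"
  shows "gcd a (Lcm S) dvd x"
  using assms
proof (induction S rule: finite_induct)
  case (insert s S)
  have "gcd a (lcm s (Lcm S)) = lcm (gcd a s) (gcd a (Lcm S))"
    by (simp add: gcd_lcm_distrib)
  with insert show ?case by simp
qed simp

text \<open>Bezout splits \<open>w - u\<close>, a multiple of \<open>s * m + t * l\<close>, into a
  multiple of \<open>m\<close> and a multiple of \<open>l\<close>. Adding the first part to
  \<open>u\<close> lands where subtracting the second from \<open>w\<close> does.\<close>

lemma binary_chinese_remainder_gcd: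
  fixes u w :: int
  assumes "[u = w] (mod gcd m l)"
  shows "\<exists>z. [z = u] (mod m) \<and> [z = w] (mod l)"
proof -
  obtain s t where st: "s * m + t * l = gcd m l"
    using bezout_int by blast
  obtain k where k: "w - u = gcd m l * k"
    using assms by (metis cong_iff_dvd_diff cong_sym dvd_def)
  have "u + k * s * m = w - k * t * l"
    using k st by algebra
  then have "[u + k * s * m = w] (mod l)"
    by (simp add: cong_iff_dvd_diff)
  moreover have "[u + k * s * m = u] (mod m)"
    by (simp add: cong_iff_dvd_diff)
  ultimately have "[u + k * s * m = u] (mod m) \<and> [u + k * s * m = w] (mod l)" by simp
  then show ?thesis by blast
qed

text \<open>Induction on \<open>I\<close>: the solution \<open>z\<close> for the old indices may be
  altered by multiples of the lcm of their moduli, so a new congruence needs only the two-moduli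
  case with this lcm as one modulus.\<close>

lemma chinese_remainder_gcd:
  fixes r a :: "'i \<Rightarrow> int"
  assumes "finite I" "\<And>i j. i \<in> I \<Longrightarrow> j \<in> I \<Longrightarrow> [r i = r j] (mod gcd (a i) (a j))"
  shows "\<exists>z. \<forall>i\<in>I. [z = r i] (mod a i)"
  using assms
proof (induction I rule: finite_induct)
  case (insert k I)
  then obtain z where z: "[z = r i] (mod a i)" if "i \<in> I" for i
    by blast
  have "gcd (a k) s dvd r k - z" if "s \<in> a ` I" for s
  proof -
    obtain i where i: "i \<in> I" "s = a i" using \<open>s \<in> a ` I\<close> by blast
    have "[r k = r i] (mod gcd (a k) s)" using insert.prems[of k i] i by simp
    moreover have "[z = r i] (mod gcd (a k) s)"
      using z[OF i(1)] i(2) cong_dvd_modulus by (metis gcd_dvd2)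
    ultimately show ?thesis by (meson cong_iff_dvd_diff cong_sym cong_trans)
  qed
  then have "[r k = z] (mod gcd (a k) (Lcm (a ` I)))"
    using dvd_gcd_Lcm_int[of "a ` I"] insert.hyps by (simp add: cong_iff_dvd_diff)
  then obtain y where y: "[y = r k] (mod a k)" "[y = z] (mod Lcm (a ` I))"
    using binary_chinese_remainder_gcd by blast
  have "[y = r i] (mod a i)" if "i \<in> I" for i
    using y(2) z[OF that] that by (meson cong_dvd_modulus cong_trans dvd_Lcm imageI)
  with y(1) show ?case by blast
qed simp

section \<open>Effect of the graph operations on splines\<close>

lemma edge_weighted_graphD:
  assumes "edge_weighted_graph G" "(e, a) \<in># edges G"
  shows "e \<subseteq> verts G" "card e = 2" "a > 0"
  using assms unfolding edge_weighted_graph_def by auto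

lemma splines_edge_collapse:
  assumes "edge_collapse G H"
  shows "splines H = splines G \<and> verts H = verts G"
proof -
  obtain p C where C: "C \<subseteq># edges G" "size C \<ge> 2" "\<forall>x \<in># C. fst x = p"
    and H: "H = G\<lparr>edges := edges G - C + {#(p, Lcm (snd ` set_mset C))#}\<rparr>"
    using assms unfolding edge_collapse_def by blast
  \<comment> \<open>\<open>R g x\<close> is the condition imposed by a single edge. Being a spline
    thus becomes a universal statement over edges, in which the edges of \<open>C\<close> can be
    traded for the one edge of lcm weight.\<close>
  define R where "R g x \<longleftrightarrow> (\<forall>i j. {i, j} = fst x \<longrightarrow> [g i = g j] (mod snd x))"
    for g :: "nat \<Rightarrow> int" and x
  have splines_R: "splines K = {g. (\<forall>i. i \<notin> verts K \<longrightarrow> g i = 0) \<and> (\<forall>x\<in>#edges K. R g x)}" for K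
    unfolding splines_def R_def by fastforce
  have "(\<forall>x\<in>#edges G. R g x) \<longleftrightarrow> (\<forall>x\<in>#edges H. R g x)" for g
  proof -
    have "R g (p, Lcm (snd ` set_mset C)) \<longleftrightarrow>
        (\<forall>i j. {i, j} = p \<longrightarrow> (\<forall>x\<in>#C. [g i = g j] (mod snd x)))"
      by (simp add: R_def cong_iff_dvd_diff Lcm_dvd_iff)
    also have "\<dots> \<longleftrightarrow> (\<forall>x\<in>#C. R g x)"
      using C(3) unfolding R_def by metis
    finally have "(\<forall>x\<in>#edges H. R g x) \<longleftrightarrow> (\<forall>x\<in>#edges G - C + C. R g x)"
      unfolding H by auto
    then show ?thesis using C(1) by simp
  qed
  then show ?thesis unfolding splines_R by (simp add: H)
qed

lemma splines_edge_collapses: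
  "edge_collapse\<^sup>*\<^sup>* G H \<Longrightarrow> splines H = splines G \<and> verts H = verts G"
  by (induction rule: rtranclp_induct) (auto dest: splines_edge_collapse)

text \<open>Tuples vanish off the vertex set, so deleting the entry at \<open>v\<close> means
  setting it to \<open>0\<close>. Two edges at \<open>v\<close> force a congruence modulo the gcd of
  their weights; conversely these congruences let the Chinese remainder theorem supply a value at
  \<open>v\<close>.\<close>

lemma splines_star_clique:
  assumes G: "edge_weighted_graph G" and v: "v \<in> verts G"
  shows "splines (star_clique v G) = (\<lambda>g. g(v := 0)) ` splines G"
proof -
  define N where "N = {(x, a). ({v, x}, a) \<in># edges G}"
  have "N \<subseteq> verts G \<times> snd ` set_mset (edges G)"
  proof
    fix p assume "p \<in> N"
    then obtain x a where p: "p = (x, a)" and e: "({v, x}, a) \<in># edges G"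
      unfolding N_def by blast
    show "p \<in> verts G \<times> snd ` set_mset (edges G)"
      using edge_weighted_graphD(1)[OF G e] image_eqI[OF _ e, of a snd] p by simp
  qed
  moreover have "finite (verts G)" using G by (simp add: edge_weighted_graph_def)
  ultimately have fN: "finite N" by (meson finite_SigmaI finite_imageI finite_set_mset finite_subset)
  have Nv: "x \<noteq> v" if "(x, a) \<in> N" for x a
    using edge_weighted_graphD(2)[OF G, of "{v, x}" a] that unfolding N_def by auto
  define P where "P = {((x, a), (y, b)). (x, a) \<in> N \<and> (y, b) \<in> N \<and> x < y}"
  have "P \<subseteq> N \<times> N" unfolding P_def by auto
  \<comment> \<open>Finiteness matters because \<open>mset_set\<close> of an infinite set is empty;
    only with it do the elements of \<open>P\<close> yield edges.\<close>
  then have fP: "finite P" using fN finite_subset by blast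
  have SC: "z \<in># edges (star_clique v G) \<longleftrightarrow> (z \<in># edges G \<and> v \<notin> fst z) \<or>
      (\<exists>x a y b. (x, a) \<in> N \<and> (y, b) \<in> N \<and> x < y \<and> z = ({x, y}, gcd a b))" for z
  proof -
    have "edges (star_clique v G) = {#(e, a) \<in># edges G. v \<notin> e#} +
        image_mset (\<lambda>((x, a), (y, b)). ({x, y}, gcd a b)) (mset_set P)"
      by (simp add: star_clique_def P_def N_def)
    then show ?thesis using fP
      by (cases z) (force simp: P_def)
  qed
  show ?thesis
  proof (intro set_eqI iffI)
    fix h assume h: "h \<in> splines (star_clique v G)"
    have hE: "[h i = h j] (mod a)" if "({i, j}, a) \<in># edges (star_clique v G)" for i j a
      using h that unfolding splines_def by blast
    have hN: "[h x = h y] (mod gcd a b)" if "(x, a) \<in> N" "(y, b) \<in> N" "x < y" for x a y b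
    proof (rule hE)
      show "({x, y}, gcd a b) \<in># edges (star_clique v G)"
        unfolding SC using that by blast
    qed
    \<comment> \<open>The clique has edges only for \<open>x < y\<close>; symmetry gives the reverse
      order, and for \<open>x = y\<close> the congruence is trivial.\<close>
    have "[h (fst p) = h (fst q)] (mod gcd (snd p) (snd q))" if "p \<in> N" "q \<in> N" for p q
    proof -
      obtain x a y b where pq: "p = (x, a)" "q = (y, b)" by fastforce
      consider "x < y" | "x = y" | "y < x" by linarith
      then show ?thesis
      proof cases
        case 1
        then show ?thesis using hN that pq by auto
      next
        case 2
        then show ?thesis using pq by simp
      next
        case 3
        then have "[h y = h x] (mod gcd b a)" using hN that pq by auto
        then show ?thesis using pq by (simp add: cong_sym gcd.commute)
      qed
    qed
    from chinese_remainder_gcd[OF fN this]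
    obtain z where z: "[z = h x] (mod a)" if "(x, a) \<in> N" for x a by force
    have zero: "h v = 0" "\<And>i. i \<notin> verts G \<Longrightarrow> h i = 0"
      using h unfolding splines_def star_clique_def by auto
    have "h(v := z) \<in> splines G"
      unfolding splines_def
    proof (intro CollectI conjI allI impI)
      show "(h(v := z)) i = 0" if "i \<notin> verts G" for i
        using that zero v by auto
      fix i j a assume e: "({i, j}, a) \<in># edges G"
      show "[(h(v := z)) i = (h(v := z)) j] (mod a)"
      proof (cases "i = v \<or> j = v")
        case True
        then show ?thesis using e z[of i a] z[of j a]
          by (elim disjE) (simp_all add: N_def insert_commute cong_sym)
      next
        case False
        then show ?thesis using hE[of i j a] SC e by auto
      qed
    qed
    \<comment> \<open>\<open>v\<close> is no vertex of the star-clique, so \<open>h v = 0\<close>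
      and erasing \<open>z\<close> recovers \<open>h\<close>.\<close>
    moreover have "h = (h(v := z))(v := 0)" using zero by auto
    ultimately show "h \<in> (\<lambda>g. g(v := 0)) ` splines G" by blast
  next
    fix h assume "h \<in> (\<lambda>g. g(v := 0)) ` splines G"
    then obtain g where g: "g \<in> splines G" and h: "h = g(v := 0)" by blast
    have gE: "[g i = g j] (mod a)" if "({i, j}, a) \<in># edges G" for i j a
      using g that unfolding splines_def by blast
    show "h \<in> splines (star_clique v G)"
      unfolding splines_def
    proof (intro CollectI conjI allI impI)
      show "h i = 0" if "i \<notin> verts (star_clique v G)" for i
        using that g unfolding splines_def h star_clique_def by auto
      fix i j c assume "({i, j}, c) \<in># edges (star_clique v G)"
      then consider "({i, j}, c) \<in># edges G" "v \<notin> {i, j}"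
        | x a y b where "(x, a) \<in> N" "(y, b) \<in> N" "{i, j} = {x, y}" "c = gcd a b"
        using SC by auto
      then show "[h i = h j] (mod c)"
      proof cases
        case 1
        then show ?thesis using gE h by auto
      next
        case 2
        \<comment> \<open>The deleted value \<open>g v\<close> mediates: \<open>c\<close> divides
          both weights \<open>a\<close> and \<open>b\<close>.\<close>
        have "[g v = g x] (mod c)" "[g v = g y] (mod c)"
          using 2 gE[of v x a] gE[of v y b] cong_dvd_modulus[of _ _ _ c] unfolding N_def by auto
        then have "[g x = g y] (mod c)" "[g y = g x] (mod c)"
          by (meson cong_sym cong_trans)+
        then show ?thesis
          using 2(3) Nv[OF 2(1)] Nv[OF 2(2)] unfolding h by (auto simp: doubleton_eq_iff)
      qed
    qed
  qed
qed

section \<open>Isomorphisms of integer modules\<close>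

lemma zscale_apply [simp]: "zscale c f x = c * f x"
  by (simp add: zscale_def)

lemma sum_apply: "(\<Sum>i\<in>A. f i) x = (\<Sum>i\<in>A. f i x)" for f :: "'i \<Rightarrow> 'a \<Rightarrow> int"
  by (induction A rule: infinite_finite_induct) auto

text \<open>The inverse inherits linearity from injectivity of the map on \<open>M\<close>. Closure
  of \<open>M\<close> is what allows injectivity to be applied to sums and multiples of
  preimages.\<close>

lemma zmod_isomorphic_sym:
  assumes iso: "zmod_isomorphic s1 s2 M N"
    and add: "\<And>x y. x \<in> M \<Longrightarrow> y \<in> M \<Longrightarrow> x + y \<in> M"
    and scale: "\<And>c x. x \<in> M \<Longrightarrow> s1 c x \<in> M"
  shows "zmod_isomorphic s2 s1 N M"
proof -
  obtain f where f: "zmod_hom_on s1 s2 M N f" and bij: "bij_betw f M N"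
    using iso unfolding zmod_isomorphic_def by blast
  define h where "h = inv_into M f"
  have hM: "h y \<in> M" and fh: "f (h y) = y" if "y \<in> N" for y
    using bij that unfolding h_def
    by (auto simp: bij_betw_def f_inv_into_f inv_into_into)
  have hf: "h (f x) = x" if "x \<in> M" for x
    using bij that unfolding h_def by (simp add: bij_betw_def)
  have "h (x + y) = h x + h y" if "x \<in> N" "y \<in> N" for x y
    using f hf[OF add[OF hM hM]] fh hM that by (simp add: zmod_hom_on_def)
  moreover have "h (s2 c x) = s1 c (h x)" if "x \<in> N" for c x
  proof -
    have "f (s1 c (h x)) = s2 c x"
      using f fh hM that by (simp add: zmod_hom_on_def)
    then show ?thesis using hf[OF scale[OF hM[OF that]]] by metis
  qed
  ultimately have "zmod_hom_on s2 s1 N M h"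
    using hM by (simp add: zmod_hom_on_def)
  moreover have "bij_betw h N M"
    unfolding h_def using bij by (rule bij_betw_inv_into)
  ultimately show ?thesis unfolding zmod_isomorphic_def by blast
qed

lemma zmod_isomorphic_trans:
  assumes "zmod_isomorphic s1 s2 M N" "zmod_isomorphic s2 s3 N P"
  shows "zmod_isomorphic s1 s3 M P"
proof -
  obtain f g where f: "zmod_hom_on s1 s2 M N f" "bij_betw f M N"
    and g: "zmod_hom_on s2 s3 N P g" "bij_betw g N P"
    using assms unfolding zmod_isomorphic_def by blast
  have "zmod_hom_on s1 s3 M P (g \<circ> f)"
    using f(1) g(1) by (auto simp: zmod_hom_on_def Pi_iff)
  moreover have "bij_betw (g \<circ> f) M P"
    using f(2) g(2) by (rule bij_betw_trans)
  ultimately show ?thesis unfolding zmod_isomorphic_def by blast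
qed

section \<open>Triangular bases\<close>

text \<open>At coordinate \<open>k\<close> the terms with \<open>i > k\<close> vanish by
  triangularity and those with \<open>i < k\<close> by induction, leaving
  \<open>c k * M k k = 0\<close>.\<close>

lemma triangular_coeff_zero:
  fixes M :: "nat \<Rightarrow> nat \<Rightarrow> int"
  assumes tri: "\<And>i j. i \<in> {1..n} \<Longrightarrow> j \<in> {1..<i} \<Longrightarrow> M i j = 0"
    and diag: "\<And>i. i \<in> {1..n} \<Longrightarrow> M i i \<noteq> 0"
    and zero: "(\<Sum>i\<in>{1..n}. zscale (c i) (M i)) = 0"
    and k: "k \<in> {1..n}"
  shows "c k = 0"
  using k
proof (induction k rule: less_induct)
  case (less k)
  have "c i * M i k = 0" if "i \<in> {1..n} - {k}" for i
    using that less tri[of i k] by (cases "i < k") auto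
  then have "(\<Sum>i\<in>{1..n} - {k}. c i * M i k) = 0"
    by (rule sum.neutral[OF ballI])
  then have "(\<Sum>i\<in>{1..n}. c i * M i k) = c k * M k k"
    using sum.remove[OF _ less.prems, of "\<lambda>i. c i * M i k"] by simp
  moreover have "(\<Sum>i\<in>{1..n}. c i * M i k) = 0"
    using fun_cong[OF zero, of k] by (simp add: sum_apply)
  ultimately show ?case using diag less.prems by simp
qed

text \<open>Elimination from the first coordinate onwards: once the entries before \<open>k\<close>
  are zero, \<open>M k k\<close> divides the entry at \<open>k\<close>, and subtracting a multiple
  of \<open>M k\<close> clears it without leaving \<open>S\<close>.\<close>

lemma triangular_expansion:
  fixes M :: "nat \<Rightarrow> nat \<Rightarrow> int"
  assumes S: "zmod.subspace S"
    and M: "\<And>i. i \<in> {1..n} \<Longrightarrow> M i \<in> S"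
    and supp: "\<And>g j. g \<in> S \<Longrightarrow> j \<notin> {1..n} \<Longrightarrow> g j = 0"
    and tri: "\<And>i j. i \<in> {1..n} \<Longrightarrow> j \<in> {1..<i} \<Longrightarrow> M i j = 0"
    and dvd: "\<And>g i. g \<in> S \<Longrightarrow> i \<in> {1..n} \<Longrightarrow> \<forall>j\<in>{1..<i}. g j = 0 \<Longrightarrow> M i i dvd g i"
    and g: "g \<in> S"
  shows "\<exists>c. g = (\<Sum>i\<in>{1..n}. zscale (c i) (M i))"
proof -
  have "\<exists>c. g = (\<Sum>i\<in>{k..n}. zscale (c i) (M i))"
    if "1 \<le> k" "k \<le> Suc n" "g \<in> S" "\<forall>j\<in>{1..<k}. g j = 0" for k g
    \<comment> \<open>The induction descends from \<open>Suc n\<close>, where all entries in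
      \<open>{1..n}\<close> are zero and the sum is empty.\<close>
    using that(2,1,3,4)
  proof (induction k arbitrary: g rule: inc_induct)
    case base
    then have "g j = 0" for j
      using supp[of g j] by (cases "j \<in> {1..n}") auto
    then have "g = 0" by (simp add: fun_eq_iff)
    then show ?case by simp
  next
    case (step k)
    have k: "k \<in> {1..n}" using step by simp
    obtain q where q: "g k = M k k * q"
      using dvd[OF step.prems(2) k step.prems(3)] by (auto elim: dvdE)
    define h where "h = g - zscale q (M k)"
    have "h \<in> S"
      unfolding h_def using S M k step.prems(2)
      by (simp add: zmod.subspace_diff zmod.subspace_scale)
    moreover have "h j = 0" if "j \<in> {1..<Suc k}" for j
    proof (cases "j = k")
      case True
      then show ?thesis using q by (simp add: h_def mult.commute)
    next
      case False
      then have "j \<in> {1..<k}" using that by simp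
      then show ?thesis using step.prems(3) tri[OF k] by (simp add: h_def)
    qed
    ultimately have "\<exists>c. h = (\<Sum>i\<in>{Suc k..n}. zscale (c i) (M i))"
      by (intro step.IH) simp_all
    then obtain c where c: "h = (\<Sum>i\<in>{Suc k..n}. zscale (c i) (M i))" ..
    have "g = zscale q (M k) + h" by (simp add: h_def)
    \<comment> \<open>The sum starts at \<open>Suc k\<close>, so the coefficient at \<open>k\<close>
      is free to be set to \<open>q\<close>.\<close>
    also have "h = (\<Sum>i\<in>{Suc k..n}. zscale ((c(k := q)) i) (M i))"
      unfolding c by (rule sum.cong) auto
    also have "zscale q (M k) + \<dots> = (\<Sum>i\<in>{k..n}. zscale ((c(k := q)) i) (M i))"
      using k by (simp add: sum.atLeast_Suc_atMost)
    finally show ?case by blast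
  qed
  from this[of 1 g] g show ?thesis by simp
qed

lemma triangular_basis:
  fixes M :: "nat \<Rightarrow> nat \<Rightarrow> int"
  assumes S: "zmod.subspace S"
    and M: "\<And>i. i \<in> {1..n} \<Longrightarrow> M i \<in> S"
    and tri: "\<And>i j. i \<in> {1..n} \<Longrightarrow> j \<in> {1..<i} \<Longrightarrow> M i j = 0"
    and diag: "\<And>i. i \<in> {1..n} \<Longrightarrow> M i i \<noteq> 0"
    and expand: "\<And>g. g \<in> S \<Longrightarrow> \<exists>c. g = (\<Sum>i\<in>{1..n}. zscale (c i) (M i))"
  shows "zmod.independent (M ` {1..n})" "zmod.span (M ` {1..n}) = S"
proof -
  \<comment> \<open>Independence concerns the set of vectors; injectivity turns sums over that set
    into sums over indices.\<close>
  have inj: "inj_on M {1..n}"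
  proof (rule linorder_inj_onI')
    fix i j assume "i \<in> {1..n}" "j \<in> {1..n}" "i < j"
    then show "M i \<noteq> M j" using tri[of j i] diag[of i] by auto
  qed
  show "zmod.independent (M ` {1..n})"
  proof
    assume "zmod.dependent (M ` {1..n})"
    then obtain u v where v: "v \<in> M ` {1..n}" "u v \<noteq> 0"
      and "(\<Sum>v\<in>M ` {1..n}. zscale (u v) v) = 0"
      by (auto simp: zmod.dependent_finite)
    then have zero: "(\<Sum>i\<in>{1..n}. zscale (u (M i)) (M i)) = 0"
      unfolding sum.reindex[OF inj] by (simp only: comp_def)
    have "u (M i) = 0" if "i \<in> {1..n}" for i
      by (rule triangular_coeff_zero[where M = M, OF _ _ zero that]) (erule (1) tri, erule diag)
    with v show False by blast
  qed
  show "zmod.span (M ` {1..n}) = S"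
  proof (rule zmod.span_subspace[OF _ _ S])
    show "M ` {1..n} \<subseteq> S" using M by blast
    show "S \<subseteq> zmod.span (M ` {1..n})"
    proof
      fix g assume "g \<in> S"
      with expand obtain c where "g = (\<Sum>i\<in>{1..n}. zscale (c i) (M i))" by blast
      then show "g \<in> zmod.span (M ` {1..n})"
        by (simp only:) (intro zmod.span_sum zmod.span_scale zmod.span_base imageI)
    qed
  qed
qed

text \<open>The free module of rank \<open>n\<close>, the common model through which splines and the
  direct sum of kernels are compared.\<close>

definition coords :: "nat \<Rightarrow> (nat \<Rightarrow> int) set" where
  "coords n = {c. \<forall>i. i \<notin> {1..n} \<longrightarrow> c i = 0}"

text \<open>The map takes coefficients to linear combinations; triangularity makes it injective,
  \<open>expand\<close> makes it surjective.\<close>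

lemma coords_isomorphic_triangular:
  fixes M :: "nat \<Rightarrow> nat \<Rightarrow> int"
  assumes S: "zmod.subspace S"
    and M: "\<And>i. i \<in> {1..n} \<Longrightarrow> M i \<in> S"
    and tri: "\<And>i j. i \<in> {1..n} \<Longrightarrow> j \<in> {1..<i} \<Longrightarrow> M i j = 0"
    and diag: "\<And>i. i \<in> {1..n} \<Longrightarrow> M i i \<noteq> 0"
    and expand: "\<And>g. g \<in> S \<Longrightarrow> \<exists>c. g = (\<Sum>i\<in>{1..n}. zscale (c i) (M i))"
  shows "zmod_isomorphic zscale zscale (coords n) S"
proof -
  define f where "f c = (\<Sum>i\<in>{1..n}. zscale (c i) (M i))" for c
  have fS: "f c \<in> S" for c
    unfolding f_def using S M by (intro zmod.subspace_sum zmod.subspace_scale) auto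
  have add: "f (x + y) = f x + f y" for x y
    by (simp add: f_def zmod.scale_left_distrib sum.distrib)
  have scale: "f (zscale c x) = zscale c (f x)" for c x
    by (simp add: f_def zmod.scale_sum_right)
  have "inj_on f (coords n)"
  proof (rule inj_onI)
    fix x y assume xy: "x \<in> coords n" "y \<in> coords n" "f x = f y"
    have zero: "(\<Sum>i\<in>{1..n}. zscale (x i - y i) (M i)) = 0"
      using xy(3) by (simp add: f_def zmod.scale_left_diff_distrib sum_subtractf)
    have "x i - y i = 0" if "i \<in> {1..n}" for i
      by (rule triangular_coeff_zero[where M = M, OF _ _ zero that]) (erule (1) tri, erule diag)
    with xy(1,2) have "x i = y i" for i
      by (cases "i \<in> {1..n}") (auto simp: coords_def)
    then show "x = y" ..
  qed
  moreover have "f ` coords n = S"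
  proof
    show "S \<subseteq> f ` coords n"
    proof
      fix g assume "g \<in> S"
      with expand obtain c where c: "g = f c" unfolding f_def by blast
      \<comment> \<open>The coefficients found may be arbitrary outside \<open>{1..n}\<close>;
        cutting them off puts them in \<open>coords n\<close> and leaves the sum unchanged.\<close>
      have "f c = f (\<lambda>i. if i \<in> {1..n} then c i else 0)"
        unfolding f_def by (rule sum.cong) auto
      moreover have "(\<lambda>i. if i \<in> {1..n} then c i else 0) \<in> coords n"
        by (simp add: coords_def)
      ultimately show "g \<in> f ` coords n" unfolding c by simp
    qed
  qed (use fS in blast)
  ultimately have "bij_betw f (coords n) S"
    unfolding bij_betw_def ..
  moreover have "zmod_hom_on zscale zscale (coords n) S f"
    unfolding zmod_hom_on_def using fS add scale by simp
  ultimately show ?thesis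
    unfolding zmod_isomorphic_def by blast
qed

text \<open>Each summand is infinite cyclic: a nonzero entry of \<open>m i\<close> allows the
  coefficient of a multiple of \<open>m i\<close> to be recovered.\<close>

lemma coords_isomorphic_direct_sum:
  fixes m :: "nat \<Rightarrow> nat \<Rightarrow> int"
  assumes K: "\<And>i. i \<in> {1..n} \<Longrightarrow> K i = zmod.span {m i}"
    and m: "\<And>i. i \<in> {1..n} \<Longrightarrow> m i \<noteq> 0"
  shows "zmod_isomorphic zscale dscale (coords n) (direct_sum {1..n} K)"
proof -
  define f where "f c = (\<lambda>i. if i \<in> {1..n} then zscale (c i) (m i) else 0)" for c
  have K': "K i = range (\<lambda>k. zscale k (m i))" if "i \<in> {1..n}" for i
    using K[OF that] by (simp add: zmod.span_singleton)
  have fD: "f c \<in> direct_sum {1..n} K" for c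
    by (simp add: f_def direct_sum_def K')
  have add: "f (x + y) = f x + f y" for x y
    by (simp add: f_def fun_eq_iff algebra_simps)
  have scale: "f (zscale c x) = dscale c (f x)" for c x
    by (simp add: f_def dscale_def fun_eq_iff)
  have "inj_on f (coords n)"
  proof (rule inj_onI)
    fix x y assume xy: "x \<in> coords n" "y \<in> coords n" "f x = f y"
    have "x i = y i" for i
    proof (cases "i \<in> {1..n}")
      case True
      then obtain j where "m i j \<noteq> 0" using m by (auto simp: fun_eq_iff)
      moreover have "f x i j = f y i j" using xy(3) by simp
      ultimately show ?thesis using True by (simp add: f_def)
    qed (use xy in \<open>simp add: coords_def\<close>)
    then show "x = y" ..
  qed
  moreover have "f ` coords n = direct_sum {1..n} K"
  proof
    show "direct_sum {1..n} K \<subseteq> f ` coords n"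
    proof
      fix F assume F: "F \<in> direct_sum {1..n} K"
      then have "\<exists>k. F i = zscale k (m i)" if "i \<in> {1..n}" for i
        using that K' by (auto simp: direct_sum_def)
      then obtain k where k: "F i = zscale (k i) (m i)" if "i \<in> {1..n}" for i by metis
      have "F = f (\<lambda>i. if i \<in> {1..n} then k i else 0)"
        using F k by (auto simp: f_def direct_sum_def fun_eq_iff)
      moreover have "(\<lambda>i. if i \<in> {1..n} then k i else 0) \<in> coords n"
        by (simp add: coords_def)
      ultimately show "F \<in> f ` coords n" by blast
    qed
  qed (use fD in blast)
  ultimately have "bij_betw f (coords n) (direct_sum {1..n} K)"
    unfolding bij_betw_def ..
  moreover have "zmod_hom_on zscale dscale (coords n) (direct_sum {1..n} K) f"
    unfolding zmod_hom_on_def using fD add scale by simp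
  ultimately show ?thesis
    unfolding zmod_isomorphic_def by blast
qed

section \<open>Spline modules and truncation of tuples\<close>

lemma subspace_splines: "zmod.subspace (splines G)"
  by (auto simp: zmod.subspace_def splines_def intro: cong_add cong_scalar_left)

lemma phi_apply: "phi i g j = (if 1 \<le> j \<and> j < i then g j else 0)"
  by (simp add: phi_def)

lemma phi_comp_self [simp]: "phi_comp n n = id"
  by (simp add: phi_comp_def)

lemma phi_comp_Suc: "k < n \<Longrightarrow> phi_comp k n = phi (Suc k) \<circ> phi_comp (Suc k) n"
  by (simp add: phi_comp_def upt_conv_Cons del: upt_Suc)

text \<open>Each map drops one more trailing entry. The support condition on \<open>g\<close> covers
  \<open>i = n\<close>, where the composition is the identity.\<close>

lemma phi_comp_apply:
  assumes "i \<le> n" "\<And>j. j \<notin> {1..n} \<Longrightarrow> g j = 0"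
  shows "phi_comp i n g j = (if j \<in> {1..i} then g j else 0)"
  using assms(1)
proof (induction i rule: inc_induct)
  case base
  then show ?case using assms(2) by auto
next
  case (step i)
  then show ?case by (auto simp: phi_comp_Suc phi_apply)
qed

section \<open>Complete collapse sequences\<close>

locale complete_collapse =
  fixes n :: nat and G :: wgraph and Gs :: "nat \<Rightarrow> wgraph"
  assumes verts_G: "verts G = {1..n}"
    and collapse: "complete_collapse_sequence n G Gs"
begin

lemma Gs_n: "Gs n = G"
  using collapse by (simp add: complete_collapse_sequence_def)

lemma edge_weighted_Gs: "i \<in> {1..n} \<Longrightarrow> edge_weighted_graph (Gs i)"
  using collapse by (simp add: complete_collapse_sequence_def simple_graph_def)

lemma collapse_step:
  assumes "k \<in> {1..<n}"
  shows "splines (Gs k) = splines (star_clique (Suc k) (Gs (Suc k)))"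
    and "verts (Gs k) = verts (Gs (Suc k)) - {Suc k}"
proof -
  have "\<forall>i\<in>{2..n}. edge_collapse\<^sup>*\<^sup>* (star_clique i (Gs i)) (Gs (i - 1))"
    using collapse by (simp add: complete_collapse_sequence_def)
  moreover have "Suc k \<in> {2..n}" using assms by simp
  ultimately have "edge_collapse\<^sup>*\<^sup>* (star_clique (Suc k) (Gs (Suc k))) (Gs k)"
    by fastforce
  note eq = splines_edge_collapses[OF this]
  show "splines (Gs k) = splines (star_clique (Suc k) (Gs (Suc k)))"
    by (rule eq[THEN conjunct1])
  show "verts (Gs k) = verts (Gs (Suc k)) - {Suc k}"
    unfolding eq[THEN conjunct2] by (simp add: star_clique_def)
qed

lemma verts_Gs:
  assumes "i \<in> {1..n}"
  shows "verts (Gs i) = {1..i}"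
proof -
  have "i \<le> n" using assms by simp
  then show ?thesis
  proof (induction rule: inc_induct)
    case base
    then show ?case using Gs_n verts_G by simp
  next
    case (step k)
    then have "k \<in> {1..<n}" using assms by simp
    then have "verts (Gs k) = {1..Suc k} - {Suc k}"
      using collapse_step(2) step.IH by simp
    also have "\<dots> = {1..k}" by (simp add: atLeastAtMostSuc_conv)
    finally show ?case .
  qed
qed

lemma splines_Gs_supp: "i \<in> {1..n} \<Longrightarrow> g \<in> splines (Gs i) \<Longrightarrow> j \<notin> {1..i} \<Longrightarrow> g j = 0"
  using verts_Gs by (simp add: splines_def)

lemma splines_supp: "g \<in> splines G \<Longrightarrow> j \<notin> {1..n} \<Longrightarrow> g j = 0"
  using verts_G by (simp add: splines_def)

text \<open>Splines here are supported on \<open>{1..Suc k}\<close>, so \<open>phi (Suc k)\<close>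
  only zeroes the entry at \<open>Suc k\<close>. This is the operation relating splines to those of
  the star-clique.\<close>

lemma phi_image:
  assumes "k \<in> {1..<n}"
  shows "phi (Suc k) ` splines (Gs (Suc k)) = splines (Gs k)"
proof -
  have k: "Suc k \<in> {1..n}" using assms by simp
  have "phi (Suc k) g = g(Suc k := 0)" if "g \<in> splines (Gs (Suc k))" for g
    using splines_Gs_supp[OF k that] by (auto simp: phi_apply fun_eq_iff)
  then have "phi (Suc k) ` splines (Gs (Suc k)) = (\<lambda>g. g(Suc k := 0)) ` splines (Gs (Suc k))"
    by (rule image_cong[OF refl])
  also have "\<dots> = splines (star_clique (Suc k) (Gs (Suc k)))"
    using splines_star_clique[OF edge_weighted_Gs[OF k]] verts_Gs[OF k] by simp
  finally show ?thesis using collapse_step(1)[OF assms] by simp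
qed

lemma phi_comp_image:
  assumes "i \<in> {1..n}"
  shows "phi_comp i n ` splines G = splines (Gs i)"
proof -
  have "i \<le> n" using assms by simp
  then show ?thesis
  proof (induction rule: inc_induct)
    case base
    then show ?case using Gs_n by simp
  next
    case (step k)
    then show ?case using phi_image[of k] assms by (simp add: phi_comp_Suc flip: image_image)
  qed
qed

section \<open>The kernels and their generators\<close>

text \<open>The case \<open>i = 1\<close> needs no exception: \<open>Gs 1\<close> has no edges, and the empty lcm is \<open>1\<close>.\<close>

lemma kernel_gen_apply:
  assumes "i \<in> {1..n}"
  shows "kernel_gen Gs i = (\<lambda>j. if j = i then Lcm {c. \<exists>e. (e, c) \<in># edges (Gs i) \<and> i \<in> e} else 0)"
proof -
  have "{c. \<exists>e. (e, c) \<in># edges (Gs 1) \<and> 1 \<in> e} = {}" if "i = 1"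
  proof -
    have "False" if "(e, c) \<in># edges (Gs 1)" for e c
    proof -
      have "e \<subseteq> {1}" "card e = 2"
        using edge_weighted_graphD[OF edge_weighted_Gs that] verts_Gs[of 1] assms \<open>i = 1\<close> by auto
      then show False by (auto simp: subset_singleton_iff)
    qed
    then show ?thesis by blast
  qed
  then show ?thesis by (auto simp: kernel_gen_def fun_eq_iff)
qed

text \<open>The lcm is taken over finitely many positive weights, so it is not
  \<open>0\<close>.\<close>

lemma kernel_gen_pos:
  assumes "i \<in> {1..n}"
  shows "kernel_gen Gs i i > 0"
proof -
  define W where "W = {c. \<exists>e. (e, c) \<in># edges (Gs i) \<and> i \<in> e}"
  have "W \<subseteq> snd ` set_mset (edges (Gs i))" unfolding W_def by force
  then have "finite W" by (rule finite_subset) simp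
  moreover have "0 \<notin> W"
    using edge_weighted_graphD(3)[OF edge_weighted_Gs[OF assms]] unfolding W_def by fastforce
  ultimately have "Lcm W \<noteq> 0" by (simp add: Lcm_0_iff)
  then have "Lcm W > 0" by (simp add: order_less_le)
  then show ?thesis by (simp add: kernel_gen_apply[OF assms] W_def)
qed

text \<open>A spline in the kernel lives at \<open>i\<close> alone. An edge at \<open>i\<close> then
  says that its weight divides \<open>g i\<close>, and any other edge says
  \<open>0 = 0\<close>.\<close>

lemma ker_phi_iff:
  assumes i: "i \<in> {1..n}"
  shows "g \<in> ker_phi Gs i \<longleftrightarrow> (\<forall>j. j \<noteq> i \<longrightarrow> g j = 0) \<and> kernel_gen Gs i i dvd g i"
proof -
  have L: "kernel_gen Gs i i dvd g i \<longleftrightarrow>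
      (\<forall>c e. (e, c) \<in># edges (Gs i) \<and> i \<in> e \<longrightarrow> c dvd g i)"
    by (auto simp: kernel_gen_apply[OF i] Lcm_dvd_iff)
  have V: "verts (Gs i) = {1..i}" by (rule verts_Gs[OF i])
  show ?thesis
  proof (intro iffI conjI allI impI)
    assume g: "g \<in> ker_phi Gs i"
    show zero: "g j = 0" if "j \<noteq> i" for j
    proof (cases "j \<in> {1..i}")
      case True
      then have "phi i g j = g j" using that by (simp add: phi_apply)
      then show ?thesis using g by (simp add: ker_phi_def)
    next
      case False
      then show ?thesis using g splines_Gs_supp[OF i] by (simp add: ker_phi_def)
    qed
    show "kernel_gen Gs i i dvd g i"
      unfolding L
    proof (intro allI impI, elim conjE)
      fix c e assume e: "(e, c) \<in># edges (Gs i)" "i \<in> e"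
      then obtain j where j: "e = {i, j}" "j \<noteq> i"
        using edge_weighted_graphD(2)[OF edge_weighted_Gs[OF i] e(1)]
        by (auto simp: card_2_iff doubleton_eq_iff)
      then have "[g i = g j] (mod c)" using g e by (auto simp: ker_phi_def splines_def)
      then show "c dvd g i" using zero[OF j(2)] by (simp add: cong_0_iff)
    qed
  next
    assume g: "(\<forall>j. j \<noteq> i \<longrightarrow> g j = 0) \<and> kernel_gen Gs i i dvd g i"
    have "[g a = g b] (mod c)" if "({a, b}, c) \<in># edges (Gs i)" for a b c
    proof -
      have "i \<in> {a, b} \<Longrightarrow> [g i = 0] (mod c)"
        using g that unfolding L cong_0_iff by blast
      then show ?thesis using g by (cases "a = i"; cases "b = i") (auto simp: cong_sym)
    qed
    then have "g \<in> splines (Gs i)" using g V i by (auto simp: splines_def)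
    moreover have "phi i g = 0" using g by (auto simp: phi_apply fun_eq_iff)
    ultimately show "g \<in> ker_phi Gs i" by (simp add: ker_phi_def)
  qed
qed

lemma span_kernel_gen:
  assumes "i \<in> {1..n}"
  shows "zmod.span {kernel_gen Gs i} = ker_phi Gs i"
proof -
  have off: "kernel_gen Gs i j = 0" if "j \<noteq> i" for j
    using that by (simp add: kernel_gen_def)
  have "g \<in> range (\<lambda>k. zscale k (kernel_gen Gs i)) \<longleftrightarrow> g \<in> ker_phi Gs i" for g
    unfolding ker_phi_iff[OF assms]
  proof safe
    assume g: "\<forall>j. j \<noteq> i \<longrightarrow> g j = 0" and "kernel_gen Gs i i dvd g i"
    then obtain k where "g i = kernel_gen Gs i i * k" by blast
    then have "g j = zscale k (kernel_gen Gs i) j" for j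
      using g off by (cases "j = i") simp_all
    then have "g = zscale k (kernel_gen Gs i)" ..
    then show "g \<in> range (\<lambda>k. zscale k (kernel_gen Gs i))" by blast
  qed (use off in simp_all)
  then show ?thesis by (simp add: zmod.span_singleton set_eq_iff)
qed

lemma kernel_gen_nonzero: "i \<in> {1..n} \<Longrightarrow> kernel_gen Gs i \<noteq> 0"
  using kernel_gen_pos by (metis less_irrefl zero_fun_apply)

lemma has_rank_ker_phi:
  assumes "i \<in> {1..n}"
  shows "has_rank (ker_phi Gs i) 1"
proof -
  have "zmod.independent {kernel_gen Gs i}"
    using kernel_gen_pos[OF assms] by (force simp: zmod.dependent_finite fun_eq_iff)
  then show ?thesis
    unfolding has_rank_def using span_kernel_gen[OF assms]
    by (intro exI[of _ "{kernel_gen Gs i}"]) simp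
qed

lemma kernel_gen_in_splines: "i \<in> {1..n} \<Longrightarrow> kernel_gen Gs i \<in> splines (Gs i)"
  using span_kernel_gen[of i] zmod.span_base[of "kernel_gen Gs i"] by (auto simp: ker_phi_def)

text \<open>Truncating \<open>g\<close> to its first \<open>i\<close> entries gives a spline on
  \<open>Gs i\<close> that lies in the kernel. This divisibility drives both the expansion and the
  minimality of preimages.\<close>

lemma kernel_gen_dvd:
  assumes "g \<in> splines G" "i \<in> {1..n}" "\<forall>j\<in>{1..<i}. g j = 0"
  shows "kernel_gen Gs i i dvd g i"
proof -
  have val: "phi_comp i n g j = (if j \<in> {1..i} then g j else 0)" for j
    using assms splines_supp by (intro phi_comp_apply) auto
  have "phi_comp i n g \<in> splines (Gs i)"
    using phi_comp_image[OF assms(2)] assms(1) by blast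
  moreover have "phi i (phi_comp i n g) = 0"
    using assms(3) by (auto simp: phi_apply val fun_eq_iff)
  ultimately have "phi_comp i n g \<in> ker_phi Gs i" by (simp add: ker_phi_def)
  then show ?thesis using assms(2) by (auto simp: ker_phi_iff[OF assms(2)] val)
qed

lemma preimage_apply:
  assumes "g \<in> splines G" "phi_comp i n g = kernel_gen Gs i" "i \<in> {1..n}" "j \<in> {1..i}"
  shows "g j = kernel_gen Gs i j"
  using phi_comp_apply[of i n g j] splines_supp assms by auto

section \<open>Bases formed by preimages of the generators\<close>

context
  fixes M :: "nat \<Rightarrow> nat \<Rightarrow> int"
  \<comment> \<open>At \<open>i = n\<close> the composition is the identity, so this includes
    \<open>M n = kernel_gen Gs n\<close>.\<close>
  assumes M: "\<And>i. i \<in> {1..n} \<Longrightarrow> M i \<in> splines G \<and> phi_comp i n (M i) = kernel_gen Gs i"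
begin

lemma preimage_below: "i \<in> {1..n} \<Longrightarrow> j \<in> {1..<i} \<Longrightarrow> M i j = 0"
  using preimage_apply[of "M i" i j] M[of i] by (simp add: kernel_gen_def)

lemma preimage_diag: "i \<in> {1..n} \<Longrightarrow> M i i = kernel_gen Gs i i"
  using preimage_apply[of "M i" i i] M[of i] by simp

lemma preimage_diag_nonzero: "i \<in> {1..n} \<Longrightarrow> M i i \<noteq> 0"
  using preimage_diag kernel_gen_pos by force

lemma preimage_expansion: "g \<in> splines G \<Longrightarrow> \<exists>c. g = (\<Sum>i\<in>{1..n}. zscale (c i) (M i))"
  by (rule triangular_expansion[OF subspace_splines])
    (use M splines_supp preimage_below preimage_diag kernel_gen_dvd in auto)

lemma preimage_flow_up:
  assumes "i \<in> {1..n}"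
  shows "M i \<in> flow_up n G (i - 1)"
proof -
  have "Suc (i - 1) = i" "i - 1 < n" using assms by auto
  then show ?thesis
    using M[OF assms] preimage_below[OF assms] preimage_diag_nonzero[OF assms]
    by (auto simp: flow_up_def)
qed

text \<open>The leading term of \<open>F\<close> is a nonzero multiple of the positive diagonal
  entry, hence at least as large in absolute value.\<close>

lemma preimage_minimal:
  assumes "i < n"
  shows "minimal_element n G i (M (Suc i))"
proof -
  have i: "Suc i \<in> {1..n}" using assms by simp
  have "M (Suc i) (Suc i) \<le> \<bar>F (Suc i)\<bar>" if F: "F \<in> flow_up n G i" for F
  proof -
    have F': "F \<in> splines G" "\<forall>j\<in>{1..i}. F j = 0" "F (Suc i) \<noteq> 0"
      using F assms by (auto simp: flow_up_def)
    then have "M (Suc i) (Suc i) dvd F (Suc i)"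
      using kernel_gen_dvd[OF F'(1) i] preimage_diag[OF i] by auto
    then show ?thesis using F'(3) by (simp add: dvd_imp_le_int order.trans[OF abs_ge_self])
  qed
  then show ?thesis
    using preimage_flow_up[OF i] preimage_diag[OF i] kernel_gen_pos[OF i]
    by (simp add: minimal_element_def leading_term_def)
qed

lemma preimage_flow_up_class_basis: "flow_up_class_basis n G (M ` {1..n})"
proof -
  \<comment> \<open>Flow-up classes are numbered from \<open>0\<close> and preimages from
    \<open>1\<close>, hence the shift.\<close>
  have "M ` {1..n} = (\<lambda>i. M (Suc i)) ` {0..<n}"
    by (simp only: image_comp[symmetric, unfolded comp_def, of M Suc] image_Suc_atLeastLessThan)
      (simp add: atLeastLessThanSuc_atLeastAtMost)
  moreover have "zmod.independent (M ` {1..n})" "zmod.span (M ` {1..n}) = splines G"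
    by (rule triangular_basis[OF subspace_splines];
        use M preimage_below preimage_diag_nonzero preimage_expansion in blast)+
  ultimately show ?thesis
    unfolding flow_up_class_basis_def using preimage_minimal by blast
qed

text \<open>Both modules have coordinates in \<open>coords n\<close>: one with respect to the
  preimages \<open>M\<close>, the other with respect to the kernel generators.\<close>

lemma splines_isomorphic_direct_sum:
  "zmod_isomorphic zscale dscale (splines G) (direct_sum {1..n} (ker_phi Gs))"
proof -
  have "zmod_isomorphic zscale zscale (coords n) (splines G)"
    using coords_isomorphic_triangular[where M = M, OF subspace_splines]
      M preimage_below preimage_diag_nonzero preimage_expansion by blast
  then have "zmod_isomorphic zscale zscale (splines G) (coords n)"
    by (rule zmod_isomorphic_sym) (auto simp: coords_def)
  moreover have "zmod_isomorphic zscale dscale (coords n) (direct_sum {1..n} (ker_phi Gs))"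
    by (rule coords_isomorphic_direct_sum[OF span_kernel_gen[symmetric] kernel_gen_nonzero])
  ultimately show ?thesis by (rule zmod_isomorphic_trans)
qed

end

lemma preimage_exists:
  "i \<in> {1..n} \<Longrightarrow> \<exists>M \<in> splines G. phi_comp i n M = kernel_gen Gs i"
  using phi_comp_image[of i] kernel_gen_in_splines[of i] by (metis imageE)

lemma phi_hom:
  assumes "i \<in> {2..n}"
  shows "zmod_hom_on zscale zscale (splines (Gs i)) (splines (Gs (i - 1))) (phi i)"
proof -
  have "i - 1 \<in> {1..<n}" "Suc (i - 1) = i" using assms by auto
  then have "phi i ` splines (Gs i) = splines (Gs (i - 1))"
    using phi_image[of "i - 1"] by simp
  then have "phi i \<in> splines (Gs i) \<rightarrow> splines (Gs (i - 1))" by blast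
  then show ?thesis by (simp add: zmod_hom_on_def phi_def fun_eq_iff)
qed

end

theorem theorem4p3:
  fixes n :: nat and G :: wgraph and Gs :: "nat \<Rightarrow> wgraph"
  assumes "n \<ge> 1"
    and "simple_graph G"
    and "verts G = {1..n}"
    and "complete_collapse_sequence n G Gs"
  shows
    "(\<forall>i\<in>{2..n}. zmod_hom_on zscale zscale (splines (Gs i)) (splines (Gs (i - 1))) (phi i)) \<and>
     zmod_hom_on zscale zscale (splines (Gs 1)) {0} (phi 1) \<and>
     zmod_isomorphic zscale dscale (splines G) (direct_sum {1..n} (ker_phi Gs)) \<and>
     (\<forall>i\<in>{1..n}. ker_phi Gs i \<subseteq> splines (Gs i) \<and> zmod.subspace (ker_phi Gs i) \<and>
                 has_rank (ker_phi Gs i) 1) \<and>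
     (\<forall>i\<in>{1..n}. zmod.span {kernel_gen Gs i} = ker_phi Gs i) \<and>
     (\<forall>i\<in>{1..<n}. \<exists>M \<in> splines G. phi_comp i n M = kernel_gen Gs i) \<and>
     (\<forall>M :: nat \<Rightarrow> nat \<Rightarrow> int.
        (\<forall>i\<in>{1..<n}. M i \<in> splines G \<and> phi_comp i n (M i) = kernel_gen Gs i) \<and>
        M n = kernel_gen Gs n \<longrightarrow>
        flow_up_class_basis n G (M ` {1..n}) \<and>
        (\<forall>i\<in>{1..n}. M i \<in> flow_up n G (i - 1)))"
proof -
  interpret complete_collapse n G Gs
    using assms by unfold_locales
  \<comment> \<open>The isomorphism needs some family of preimages; surjectivity of the truncations
    allows one to be chosen.\<close>
  obtain M where "\<And>i. i \<in> {1..n} \<Longrightarrow> M i \<in> splines G \<and> phi_comp i n (M i) = kernel_gen Gs i"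
    using preimage_exists by metis
  then have iso: "zmod_isomorphic zscale dscale (splines G) (direct_sum {1..n} (ker_phi Gs))"
    by (rule splines_isomorphic_direct_sum)
  have basis: "flow_up_class_basis n G (M ` {1..n}) \<and> (\<forall>i\<in>{1..n}. M i \<in> flow_up n G (i - 1))"
    if "\<forall>i\<in>{1..<n}. M i \<in> splines G \<and> phi_comp i n (M i) = kernel_gen Gs i"
      "M n = kernel_gen Gs n" for M
  proof -
    have M: "M i \<in> splines G \<and> phi_comp i n (M i) = kernel_gen Gs i" if "i \<in> {1..n}" for i
    \<comment> \<open>For \<open>i = n\<close> the generator is itself a spline on
      \<open>Gs n = G\<close>, and \<open>phi_comp n n\<close> is the identity.\<close>
    proof (cases "i = n")
      case True
      then show ?thesis
        using \<open>M n = _\<close> kernel_gen_in_splines[OF that] Gs_n by simp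
    next
      case False
      then show ?thesis using that \<open>\<forall>i\<in>{1..<n}. _ i\<close> by simp
    qed
    show ?thesis
      using preimage_flow_up_class_basis[of M, OF M] preimage_flow_up[of M, OF M] by blast
  qed
  have ker: "ker_phi Gs i \<subseteq> splines (Gs i) \<and> zmod.subspace (ker_phi Gs i)" if "i \<in> {1..n}" for i
    using span_kernel_gen[OF that, symmetric] by (auto simp: ker_phi_def)
  have "zmod_hom_on zscale zscale (splines (Gs 1)) {0} (phi 1)"
    by (auto simp: zmod_hom_on_def phi_def fun_eq_iff)
  moreover have "\<forall>i\<in>{1..<n}. \<exists>M \<in> splines G. phi_comp i n M = kernel_gen Gs i"
    using preimage_exists by simp
  ultimately show ?thesis
    using phi_hom iso ker has_rank_ker_phi span_kernel_gen basis by blast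
qed

end
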